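(* Let $\nabla_S u=\mathcal{O}(\varepsilon)$, $\hat\gamma=\mathcal{O}(\varepsilon)$ and $\nabla_S\hat\gamma=\mathcal{O}(\varepsilon)$. Then there holds $$\tilde\nu\circ\phi=\hat\nu-(\nabla_S u)^\top\hat\nu+\hat\gamma+\mathcal{O}(\varepsilon^2),$$ $$E_S(u)=\mathrm{sym}(\nabla_S^{\mathrm{cov}}u)+\mathcal{O}(\varepsilon^2),$$ $$-\big(\mathcal{H}_{\tilde\nu\circ\phi}+(1-(\tilde\nu\circ\phi)\cdot\hat\nu)\nabla_S\hat\nu-\nabla_S\hat\gamma\big)=-\big(\mathcal{H}_{\hat\nu}-\nabla_S\hat\gamma\big)+\mathcal{O}(\varepsilon^2).$$
   Context: $\mathscr{T}$ is a triangulation, by possibly curved triangles and/or quadrilaterals $T\subset\mathbb{R}^3$, approximating an oriented surface $S\subset\mathbb{R}^3$ (the mid-surface of a shell in its initial configuration); it is continuous but not necessarily $C^1$. All identities are understood element-wise. On each $T$, $\hat\nu$ is the unit normal (orientation inherited from the surface) and $P=I-\hat\nu\otimes\hat\nu$. For scalar $f$ on $T$, the surface gradient is $\nabla_S f=P\nabla\tilde F$, where $\tilde F$ is an extension of $f$ to a neighbourhood in $\mathbb{R}^3$ (the result does not depend on the extension); for vector-valued functions $\nabla_S$ is applied row-wise (the $i$-th row is $(\nabla_S u_i)^\top$). The covariant derivative is $\nabla_S^{\mathrm{cov}}u=P\nabla_S u$ and the surface Hessian of a scalar function is $\nabla_S^2f=\nabla_S^{\mathrm{cov}}(\nabla_S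 f)$. $\mathrm{sym}(A)=\frac12(A+A^\top)$. The displacement $u$ is a continuous, element-wise smooth $\mathbb{R}^3$-valued function on $\mathscr{T}$, and the shear $\hat\gamma$ is an element-wise smooth tangential vector field ($\hat\gamma\cdot\hat\nu=0$) whose edge-tangential component is continuous across elements. $\varepsilon$ is a small parameter and $\mathcal{O}$ is the Landau symbol. $\phi=\mathrm{id}+u$ is the deformation and $F=\nabla_S\phi=P+\nabla_S u$ (of rank two); $F^\dagger$ is its Moore--Penrose pseudo-inverse. The Green strain is $E_S(u)=\frac12(F^\top F-P)$. The deformed normal is $\nu\circ\phi=\frac{\mathrm{cof}(F)\hat\nu}{\|\mathrm{cof}(F)\hat\nu\|}$ with $\mathrm{cof}$ the cofactor matrix, and the director is $\tilde\nu\circ\phi=\nu\circ\phi+(F^{\dagger})^{\top}\hat\gamma$. For a vector field $n$, $\mathcal{H}_n=\sum_{i=1}^3(\nabla_S^2u_i)\,n_i$.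
   Formalization: The third identity is stated under the extra assumption that the surface Hessians of the components of u are O(ε); without it the identity fails, e.g. on a flat element with zero shear and u = (ε² sin(x/ε), 0, ε² sin(x/ε)). *)

theory Defs
  imports "HOL-Analysis.Analysis" "HOL-Library.Landau_Symbols"
begin

subsection \<open>Smooth functions\<close>

text \<open>\<open>Ck_on k f U\<close> is meant for open \<open>U\<close>.\<close>

primrec Ck_on :: "nat \<Rightarrow> ('a::real_normed_vector \<Rightarrow> 'b::real_normed_vector) \<Rightarrow> 'a set \<Rightarrow> bool" where
  "Ck_on 0 f U \<longleftrightarrow> continuous_on U f"
| "Ck_on (Suc k) f U \<longleftrightarrow>
     (\<forall>x\<in>U. f differentiable (at x)) \<and> (\<forall>h. Ck_on k (\<lambda>x. frechet_derivative f (at x) h) U)"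

definition smooth_on :: "'a::real_normed_vector set \<Rightarrow> ('a \<Rightarrow> 'b::real_normed_vector) \<Rightarrow> bool" where
  "smooth_on U f \<longleftrightarrow> (\<forall>k. Ck_on k f U)"

text \<open>A function on an element is smooth (up to the boundary of the element) if it has a smooth
  extension to a neighbourhood in the ambient space.\<close>

definition smooth_extension ::
    "'a::real_normed_vector set \<Rightarrow> ('a \<Rightarrow> 'b::real_normed_vector) \<Rightarrow> ('a \<Rightarrow> 'b) \<Rightarrow> bool" where
  "smooth_extension T f G \<longleftrightarrow> (\<exists>W. open W \<and> T \<subseteq> W \<and> smooth_on W G \<and> (\<forall>y\<in>T. G y = f y))"

definition elem_smooth :: "'a::real_normed_vector set \<Rightarrow> ('a \<Rightarrow> 'b::real_normed_vector) \<Rightarrow> bool" where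
  "elem_smooth T f \<longleftrightarrow> (\<exists>G. smooth_extension T f G)"


subsection \<open>Curved triangles and quadrilaterals\<close>

text \<open>The corners of the two reference elements, listed counterclockwise. The reference element is
  the convex hull of the corners; its sides join cyclically consecutive corners.\<close>

definition tri_corners :: "(real^2) list" where
  "tri_corners = [0, axis 1 1, axis 2 1]"

definition quad_corners :: "(real^2) list" where
  "quad_corners = [0, axis 1 1, axis 1 1 + axis 2 1, axis 2 1]"

definition corner :: "(real^2) list \<Rightarrow> nat \<Rightarrow> real^2" where
  "corner cs i = cs ! (i mod length cs)"

definition side :: "(real^2) list \<Rightarrow> nat \<Rightarrow> (real^2) set" where
  "side cs i = closed_segment (corner cs i) (corner cs (Suc i))"

text \<open>\<open>X\<close> parametrizes the element \<open>T\<close> over the reference element with corners \<open>cs\<close>.\<close>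

definition elem_chart :: "(real^3) set \<Rightarrow> (real^2) list \<Rightarrow> (real^2 \<Rightarrow> real^3) \<Rightarrow> bool" where
  "elem_chart T cs X \<longleftrightarrow>
     cs \<in> {tri_corners, quad_corners} \<and>
     T = X ` (convex hull set cs) \<and> inj_on X (convex hull set cs) \<and>
     (\<exists>W. open W \<and> convex hull set cs \<subseteq> W \<and> smooth_on W X) \<and>
     (\<forall>s \<in> convex hull set cs. inj (frechet_derivative X (at s)))"

definition curved_element :: "(real^3) set \<Rightarrow> bool" where
  "curved_element T \<longleftrightarrow> (\<exists>cs X. elem_chart T cs X)"

definition elem_vertices :: "(real^3) set \<Rightarrow> (real^3) set" where
  "elem_vertices T = {X c | cs X c. elem_chart T cs X \<and> c \<in> set cs}"

definition elem_edges :: "(real^3) set \<Rightarrow> (real^3) set set" where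
  "elem_edges T = {X ` side cs i | cs X i. elem_chart T cs X}"

definition tangent_vector :: "(real^3) set \<Rightarrow> real^3 \<Rightarrow> real^3 \<Rightarrow> bool" where
  "tangent_vector T x v \<longleftrightarrow>
     (\<exists>cs X s h. elem_chart T cs X \<and> s \<in> convex hull set cs \<and>
        x = X s \<and> v = frechet_derivative X (at s) h)"

definition edge_tangent :: "(real^3) set \<Rightarrow> (real^3) set \<Rightarrow> real^3 \<Rightarrow> real^3 \<Rightarrow> bool" where
  "edge_tangent T E x \<tau> \<longleftrightarrow>
     (\<exists>cs X i s. elem_chart T cs X \<and> E = X ` side cs i \<and> s \<in> side cs i \<and>
        x = X s \<and> \<tau> = frechet_derivative X (at s) (corner cs (Suc i) - corner cs i))"

definition unit_normal :: "(real^3) set \<Rightarrow> (real^3 \<Rightarrow> real^3) \<Rightarrow> bool" where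
  "unit_normal T n \<longleftrightarrow> elem_smooth T n \<and>
     (\<forall>x\<in>T. norm (n x) = 1 \<and> (\<forall>v. tangent_vector T x v \<longrightarrow> n x \<bullet> v = 0))"


subsection \<open>Oriented triangulations\<close>

text \<open>The edges of \<open>T\<close>, as pairs of vertices, in the direction of the boundary orientation that is
  induced by the unit normal \<open>n\<close>.\<close>

definition directed_edges :: "(real^3) set \<Rightarrow> (real^3 \<Rightarrow> real^3) \<Rightarrow> ((real^3) \<times> (real^3)) set" where
  "directed_edges T n =
     {(X (corner cs i), X (corner cs (Suc i))) | cs X i.
        elem_chart T cs X \<and>
        (\<forall>s \<in> convex hull set cs.
           n (X s) \<bullet> cross3 (frechet_derivative X (at s) (axis 1 1))
                              (frechet_derivative X (at s) (axis 2 1)) > 0)}"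

text \<open>Elements meet conformingly, so that the triangulated surface is continuous, but it may have
  kinks at the edges: the unit normal \<open>\<nu> T\<close> belongs to the element \<open>T\<close> and is two-valued on shared
  edges. The normals come from one orientation of the surface: two elements induce opposite
  directions on a common edge (in particular, an edge belongs to at most two elements).\<close>

definition oriented_triangulation :: "(real^3) set set \<Rightarrow> ((real^3) set \<Rightarrow> real^3 \<Rightarrow> real^3) \<Rightarrow> bool" where
  "oriented_triangulation \<T> \<nu> \<longleftrightarrow>
     finite \<T> \<and>
     (\<forall>T\<in>\<T>. curved_element T \<and> unit_normal T (\<nu> T)) \<and>
     (\<forall>T\<in>\<T>. \<forall>T'\<in>\<T>. T \<noteq> T' \<longrightarrow>
        T \<inter> T' = {} \<or>
        (\<exists>p \<in> elem_vertices T \<inter> elem_vertices T'. T \<inter> T' = {p}) \<or>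
        T \<inter> T' \<in> elem_edges T \<inter> elem_edges T') \<and>
     (\<forall>T\<in>\<T>. \<forall>T'\<in>\<T>. T \<noteq> T' \<longrightarrow> directed_edges T (\<nu> T) \<inter> directed_edges T' (\<nu> T') = {})"

definition displacement :: "(real^3) set set \<Rightarrow> (real^3 \<Rightarrow> real^3) \<Rightarrow> bool" where
  "displacement \<T> u \<longleftrightarrow> continuous_on (\<Union>\<T>) u \<and> (\<forall>T\<in>\<T>. elem_smooth T u)"

text \<open>The shear may jump across edges, hence it also takes the element as an argument.\<close>

definition shear ::
    "(real^3) set set \<Rightarrow> ((real^3) set \<Rightarrow> real^3 \<Rightarrow> real^3) \<Rightarrow> ((real^3) set \<Rightarrow> real^3 \<Rightarrow> real^3) \<Rightarrow> bool" where
  "shear \<T> \<nu> \<gamma> \<longleftrightarrow>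
     (\<forall>T\<in>\<T>. elem_smooth T (\<gamma> T) \<and> (\<forall>x\<in>T. \<gamma> T x \<bullet> \<nu> T x = 0)) \<and>
     (\<forall>T\<in>\<T>. \<forall>T'\<in>\<T>. \<forall>E \<in> elem_edges T \<inter> elem_edges T'. \<forall>x \<tau>.
        edge_tangent T E x \<tau> \<longrightarrow> \<gamma> T x \<bullet> \<tau> = \<gamma> T' x \<bullet> \<tau>)"


subsection \<open>Surface differential operators\<close>

text \<open>In the following \<open>T\<close> is an element and \<open>n\<close> its unit normal field.\<close>

definition tang_proj :: "real^3 \<Rightarrow> real^3^3" where
  "tang_proj n = mat 1 - (\<chi> i j. n $ i * n $ j)"

definition gradient :: "(real^3 \<Rightarrow> real) \<Rightarrow> real^3 \<Rightarrow> real^3" where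
  "gradient G x = (\<chi> i. frechet_derivative G (at x) (axis i 1))"

definition surf_grad :: "(real^3) set \<Rightarrow> (real^3 \<Rightarrow> real^3) \<Rightarrow> (real^3 \<Rightarrow> real) \<Rightarrow> real^3 \<Rightarrow> real^3" where
  "surf_grad T n f x = tang_proj (n x) *v gradient (SOME G. smooth_extension T f G) x"

definition surf_jac :: "(real^3) set \<Rightarrow> (real^3 \<Rightarrow> real^3) \<Rightarrow> (real^3 \<Rightarrow> real^3) \<Rightarrow> real^3 \<Rightarrow> real^3^3" where
  "surf_jac T n v x = (\<chi> i. surf_grad T n (\<lambda>y. v y $ i) x)"

definition surf_cov :: "(real^3) set \<Rightarrow> (real^3 \<Rightarrow> real^3) \<Rightarrow> (real^3 \<Rightarrow> real^3) \<Rightarrow> real^3 \<Rightarrow> real^3^3" where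
  "surf_cov T n v x = tang_proj (n x) ** surf_jac T n v x"

definition surf_hess :: "(real^3) set \<Rightarrow> (real^3 \<Rightarrow> real^3) \<Rightarrow> (real^3 \<Rightarrow> real) \<Rightarrow> real^3 \<Rightarrow> real^3^3" where
  "surf_hess T n f = surf_cov T n (surf_grad T n f)"


subsection \<open>Matrices\<close>

definition sym_part :: "real^'n^'n \<Rightarrow> real^'n^'n" where
  "sym_part A = (1/2) *\<^sub>R (A + transpose A)"

text \<open>The \<open>(i,j)\<close> minor with its sign: row \<open>i\<close> and column \<open>j\<close> are replaced by unit vectors.\<close>

definition cofactor_matrix :: "real^'n^'n \<Rightarrow> real^'n^'n" where
  "cofactor_matrix A =
     (\<chi> i j. det (\<chi> k l. if k = i \<and> l = j then 1 else if k = i \<or> l = j then 0 else A $ k $ l))"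

text \<open>The Moore--Penrose inverse, given by the four Penrose conditions.\<close>

definition pseudo_inverse :: "real^'n^'m \<Rightarrow> real^'m^'n" where
  "pseudo_inverse A = (THE B. A ** B ** A = A \<and> B ** A ** B = B \<and>
     transpose (A ** B) = A ** B \<and> transpose (B ** A) = B ** A)"


subsection \<open>Shell kinematics\<close>

definition def_grad :: "(real^3) set \<Rightarrow> (real^3 \<Rightarrow> real^3) \<Rightarrow> (real^3 \<Rightarrow> real^3) \<Rightarrow> real^3 \<Rightarrow> real^3^3" where
  "def_grad T n u = surf_jac T n (\<lambda>y. y + u y)"

definition green_strain :: "(real^3) set \<Rightarrow> (real^3 \<Rightarrow> real^3) \<Rightarrow> (real^3 \<Rightarrow> real^3) \<Rightarrow> real^3 \<Rightarrow> real^3^3" where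
  "green_strain T n u x =
     (1/2) *\<^sub>R (transpose (def_grad T n u x) ** def_grad T n u x - tang_proj (n x))"

text \<open>The deformed normal and the director are pulled back to the undeformed element, i.e. composed
  with the deformation.\<close>

definition deformed_normal :: "(real^3) set \<Rightarrow> (real^3 \<Rightarrow> real^3) \<Rightarrow> (real^3 \<Rightarrow> real^3) \<Rightarrow> real^3 \<Rightarrow> real^3" where
  "deformed_normal T n u x =
     (let m = cofactor_matrix (def_grad T n u x) *v n x in (1 / norm m) *\<^sub>R m)"

definition director ::
    "(real^3) set \<Rightarrow> (real^3 \<Rightarrow> real^3) \<Rightarrow> (real^3 \<Rightarrow> real^3) \<Rightarrow> (real^3 \<Rightarrow> real^3) \<Rightarrow> real^3 \<Rightarrow> real^3" where
  "director T n u g x =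
     deformed_normal T n u x + transpose (pseudo_inverse (def_grad T n u x)) *v g x"

text \<open>The matrix \<open>\<H>\<^sub>w\<close> of the displacement \<open>u\<close>, for a vector field \<open>w\<close>.\<close>

definition hess_contr ::
    "(real^3) set \<Rightarrow> (real^3 \<Rightarrow> real^3) \<Rightarrow> (real^3 \<Rightarrow> real^3) \<Rightarrow> (real^3 \<Rightarrow> real^3) \<Rightarrow> real^3 \<Rightarrow> real^3^3" where
  "hess_contr T n u w x = (\<Sum>i\<in>UNIV. (w x $ i) *\<^sub>R surf_hess T n (\<lambda>y. u y $ i) x)"


subsection \<open>Landau symbol\<close>

text \<open>\<open>f \<epsilon> = \<O>(\<epsilon>\<^sup>k)\<close> as \<open>\<epsilon>\<close> tends to 0 from above, uniformly on \<open>T\<close>: the product filter makes the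
  constant and the range of \<open>\<epsilon>\<close> independent of the point of \<open>T\<close>.\<close>

definition order_eps :: "'a set \<Rightarrow> nat \<Rightarrow> (real \<Rightarrow> 'a \<Rightarrow> 'b::real_normed_vector) \<Rightarrow> bool" where
  "order_eps T k f \<longleftrightarrow>
     (\<lambda>(\<epsilon>, x). norm (f \<epsilon> x)) \<in> O[at_right 0 \<times>\<^sub>F principal T](\<lambda>(\<epsilon>, x). \<epsilon> ^ k)"

end

theory Submission
  imports Defs
begin

text \<open>
  Write \<open>J\<close> for the surface Jacobian of \<open>u\<close> and \<open>n\<close> for the unit normal. The rows of \<open>J\<close> are
  tangential, so \<open>J n = 0\<close>. The Jacobian is built from an arbitrarily chosen extension of each
  component, hence the additivity \<open>F = P + J\<close> of the deformation gradient rests on the independence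
  of the tangential gradient from the extension (\<open>surf_grad_eq\<close>): two extensions agree on a
  two-dimensional patch, so their gradients differ by a multiple of the normal. From there on
  everything is linear algebra at one point, with constants that do not depend on the point.

  \<^emph>\<open>Deformed normal.\<close> The vector \<open>m = cof(F) n\<close> satisfies \<open>F\<^sup>T m = det(F) n = 0\<close>. For its
  normalization \<open>N\<close> this reads \<open>N = (N \<bullet> n) n - J\<^sup>T N\<close>, and since \<open>J n = 0\<close> the two terms are
  orthogonal. So \<open>1 - (N \<bullet> n)\<^sup>2 = |J\<^sup>T N|\<^sup>2\<close> is quadratic in \<open>J\<close>; if
  \<open>N \<bullet> n > 0\<close>, then so is \<open>1 - N \<bullet> n\<close>, and inserting \<open>N = n + O(J)\<close> on the right gives \<open>N = n - J\<^sup>T n + O(J\<^sup>2)\<close>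
  (\<open>unit_kernel_vector_expansion\<close>). The sign comes from \<open>m \<bullet> n = det(F + n \<otimes> n) = det(I + J)\<close>, which
  is near 1 (\<open>normal_of_perturbed_projection\<close>).

  \<^emph>\<open>Shear term.\<close> The matrix \<open>A = F + N \<otimes> n\<close> is an \<open>O(J)\<close> perturbation of the identity, and
  the Moore--Penrose inverse of \<open>F\<close> is \<open>A\<^sup>-\<^sup>1 - n \<otimes> N\<close>. Therefore \<open>w = (F\<^sup>\<dagger>)\<^sup>T g\<close>
  solves \<open>A\<^sup>T w = g\<close> for tangential \<open>g\<close>, and \<open>w = g + O(J g)\<close>
  (\<open>transpose_pseudo_inverse_expansion\<close>).

  \<^emph>\<open>Strain and bending.\<close> The strain error is exactly \<open>J\<^sup>T J / 2\<close>. In the bending identity the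
  Hessian part of the error pairs \<open>director - n = O(\<epsilon>)\<close> with Hessians of order \<open>\<epsilon>\<close>; and
  \<open>1 - director \<bullet> n\<close> is of order \<open>\<epsilon>\<^sup>2\<close>, because both first-order terms of the director are tangential,
  while the gradient of the normal is bounded on the compact element.
\<close>

section \<open>Matrices\<close>

text \<open>Keeps \<open>transpose A *v x\<close> in this form, in which the product rules below apply.\<close>

declare transpose_matrix_vector [simp del]

definition outer :: "real^'m \<Rightarrow> real^'n \<Rightarrow> real^'n^'m" where
  "outer v w = (\<chi> i j. v $ i * w $ j)"

lemma outer_mult_vec [simp]: "outer v w *v x = (w \<bullet> x) *\<^sub>R v"
  by (simp add: outer_def matrix_vector_mult_def vec_eq_iff inner_vec_def sum_distrib_left sum_distrib_right
      ac_simps)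

lemma transpose_outer [simp]: "transpose (outer v w) = outer w v"
  by (simp add: outer_def transpose_def vec_eq_iff mult.commute)

lemma mult_outer: "A ** outer v w = outer (A *v v) w"
  by (simp add: outer_def matrix_matrix_mult_def matrix_vector_mult_def vec_eq_iff
      sum_distrib_left sum_distrib_right ac_simps)

lemma outer_mult: "outer v w ** A = outer v (transpose A *v w)"
  by (simp add: outer_def matrix_matrix_mult_def matrix_vector_mult_def vec_eq_iff transpose_def
      sum_distrib_left sum_distrib_right ac_simps)

lemma tang_proj_eq: "tang_proj n = mat 1 - outer n n"
  by (simp add: tang_proj_def outer_def)

lemma tang_proj_mult_vec: "tang_proj n *v v = v - (n \<bullet> v) *\<^sub>R n"
  by (simp add: tang_proj_eq matrix_vector_mult_diff_rdistrib)

lemma matrix_diff_ldistrib: "A ** (B - C) = A ** B - A ** (C::real^'k^'n)" for A :: "real^'n^'m"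
  by (simp add: matrix_matrix_mult_def vec_eq_iff sum_subtractf algebra_simps)

lemma matrix_diff_rdistrib: "(A - B) ** C = A ** C - B ** (C::real^'k^'n)" for A :: "real^'n^'m"
  by (simp add: matrix_matrix_mult_def vec_eq_iff sum_subtractf algebra_simps)

lemma matrix_add_rdistrib: "(A + B) ** C = A ** C + B ** (C::real^'k^'n)" for A :: "real^'n^'m"
  by (simp add: matrix_matrix_mult_def vec_eq_iff sum.distrib algebra_simps)

lemma transpose_diff: "transpose (A - B) = transpose A - transpose (B::real^'n^'m)"
  by (simp add: transpose_def vec_eq_iff)

lemma transpose_add: "transpose (A + B) = transpose A + transpose (B::real^'n^'m)"
  by (simp add: transpose_def vec_eq_iff)

lemma transpose_tang_proj [simp]: "transpose (tang_proj n) = tang_proj n"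
  by (simp add: tang_proj_eq transpose_diff)

lemma inner_transpose_mult: "(transpose A *v x) \<bullet> y = x \<bullet> (A *v y)" for A :: "real^'n^'m"
  by (simp add: transpose_matrix_vector dot_lmul_matrix)

lemma norm_matrix_vector_le: "norm (A *v x) \<le> norm (A::real^'n^'m) * norm x"
proof -
  have "norm (A *v x) \<le> L2_set (\<lambda>i. norm (A $ i) * norm x) UNIV"
    unfolding norm_vec_def[of "A *v x"]
    by (rule L2_set_mono) (auto simp: matrix_mult_dot Cauchy_Schwarz_ineq2)
  then show ?thesis
    by (simp add: norm_vec_def[of A] L2_set_left_distrib)
qed

lemma norm_transpose [simp]: "norm (transpose A) = norm (A::real^'n^'m)"
proof -
  have "A \<bullet> A = transpose A \<bullet> transpose A"
    unfolding inner_vec_def transpose_def by (simp, rule sum.swap)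
  then show ?thesis by (simp add: norm_eq_sqrt_inner)
qed

lemma norm_matrix_matrix_le: "norm (A ** B) \<le> norm (A::real^'n^'m) * norm (B::real^'k^'n)"
proof -
  have row: "(A ** B) $ i = transpose B *v (A $ i)" for i
    by (simp add: matrix_matrix_mult_def matrix_vector_mult_def transpose_def vec_eq_iff mult.commute)
  have "norm (A ** B) \<le> L2_set (\<lambda>i. norm (A $ i) * norm B) UNIV"
    unfolding norm_vec_def[of "A ** B"] row
    by (rule L2_set_mono) (use norm_matrix_vector_le[of "transpose B"] in \<open>simp_all add: mult.commute[of _ "norm B"]\<close>)
  then show ?thesis
    by (simp add: norm_vec_def[of A] L2_set_left_distrib)
qed

section \<open>Cofactors and determinants\<close>

lemma det_near_identity:
  obtains d where "d > 0" "\<And>J::real^3^3. norm J < d \<Longrightarrow> det (mat 1 + J) > 0"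
proof -
  have "continuous_on UNIV (\<lambda>J::real^3^3. det (mat 1 + J))"
    unfolding det_3 by (intro continuous_intros)
  then have "((\<lambda>J::real^3^3. det (mat 1 + J)) \<longlongrightarrow> det (mat 1 + 0 :: real^3^3)) (at 0)"
    unfolding continuous_on_def by blast
  then have "\<forall>\<^sub>F J in at 0. det (mat 1 + J :: real^3^3) > 0"
    by (rule order_tendstoD) simp
  then obtain d where "d > 0" "\<forall>J::real^3^3. J \<noteq> 0 \<and> dist J 0 < d \<longrightarrow> det (mat 1 + J) > 0"
    unfolding eventually_at by auto
  then have "\<And>J::real^3^3. norm J < d \<Longrightarrow> det (mat 1 + J) > 0"
    by (metis add.right_neutral det_I dist_0_norm dist_commute zero_less_one)
  with \<open>d > 0\<close> show ?thesis using that by blast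
qed

text \<open>Laplace expansion along the columns; in dimension three it is a polynomial identity in the nine
  entries, checked by expanding both sides.\<close>

lemma transpose_mult_cofactor:
  "transpose A ** cofactor_matrix A = mat (det A)" for A :: "real^3^3"
  unfolding cofactor_matrix_def matrix_matrix_mult_def transpose_def mat_def
  by (simp add: vec_eq_iff forall_3 sum_3 det_3 algebra_simps)

text \<open>The determinant is affine in a rank-one perturbation, since a rank-one matrix has no
  nonzero minors of size two; the cofactors of \<open>A\<close> are the coefficients of the perturbation.\<close>

lemma det_rank_one_update:
  "det (A + outer v w) = det A + v \<bullet> (cofactor_matrix A *v w)" for A :: "real^3^3"
  unfolding cofactor_matrix_def matrix_vector_mult_def outer_def inner_vec_def
  by (simp add: sum_3 det_3, simp only: ring_distribs, simp only: diff_conv_add_uminus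
      minus_add_distrib mult_minus_left mult_minus_right minus_minus ac_simps)

section \<open>The Moore--Penrose inverse of a matrix of corank one\<close>

text \<open>The four Penrose conditions have at most one solution: for two solutions the symmetric
  projections \<open>A B\<close> and \<open>A C\<close> absorb each other in either order, so transposing makes them equal,
  and likewise \<open>B A\<close> and \<open>C A\<close>.\<close>

lemma pseudo_inverse_eqI:
  fixes A :: "real^'n^'m"
  assumes "A ** B ** A = A" "B ** A ** B = B"
    and "transpose (A ** B) = A ** B" "transpose (B ** A) = B ** A"
  shows "pseudo_inverse A = B"
  unfolding pseudo_inverse_def
proof (rule the_equality)
  fix C
  assume C: "A ** C ** A = A \<and> C ** A ** C = C \<and>
     transpose (A ** C) = A ** C \<and> transpose (C ** A) = C ** A"
  have "A ** B = transpose (A ** B) " by (simp add: assms)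
  also have "\<dots> = transpose (A ** C ** (A ** B))" using C by (simp add: matrix_mul_assoc)
  also have "\<dots> = A ** B ** (A ** C)" using C assms by (simp add: matrix_transpose_mul)
  also have "\<dots> = A ** C" using assms by (simp add: matrix_mul_assoc)
  finally have AB: "A ** B = A ** C" .
  have "B ** A = transpose (B ** A)" by (simp add: assms)
  also have "\<dots> = transpose (B ** A ** (C ** A))" using C by (metis matrix_mul_assoc)
  also have "\<dots> = C ** A ** (B ** A)" using C assms by (simp add: matrix_transpose_mul)
  also have "\<dots> = C ** A" using assms by (metis matrix_mul_assoc)
  finally have BA: "B ** A = C ** A" .
  show "C = B" using AB BA C assms by (metis matrix_mul_assoc)
qed (use assms in auto)

text \<open>The rank-one border \<open>N \<otimes> n\<close> maps the unit vector \<open>n\<close>, killed by \<open>F\<close>, to the unit vector \<open>N\<close>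
  orthogonal to the range of \<open>F\<close>. If the bordered matrix is invertible, removing the inverse border
  \<open>n \<otimes> N\<close> from its inverse leaves the pseudo-inverse of \<open>F\<close>: the two products with \<open>F\<close> are
  the orthogonal projections off \<open>N\<close> and off \<open>n\<close>. On vectors orthogonal to \<open>n\<close> the border drops out, so
  that applying the transposed pseudo-inverse amounts to solving a regular linear system.\<close>

lemma transpose_pseudo_inverse_bordered:
  fixes F :: "real^'n^'n"
  assumes n: "norm n = 1" "F *v n = 0" and N: "norm N = 1" "transpose F *v N = 0"
    and inv: "invertible (F + outer N n)" and g: "g \<bullet> n = 0"
  shows "transpose (F + outer N n) *v (transpose (pseudo_inverse F) *v g) = g"
proof -
  define A where "A = F + outer N n"
  obtain M where M: "A ** M = mat 1" "M ** A = mat 1"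
    using inv unfolding A_def invertible_def by blast
  define B where "B = M - outer n N"
  have nn: "n \<bullet> n = 1" "N \<bullet> N = 1" using n N by (simp_all add: norm_eq_1)
  have "A *v n = N" using n nn by (simp add: A_def matrix_vector_mult_add_rdistrib)
  then have Mn: "M *v N = n" by (metis M(2) matrix_vector_mul_assoc matrix_vector_mul_lid)
  have "transpose A *v N = n" using N nn by (simp add: A_def transpose_add matrix_vector_mult_add_rdistrib)
  moreover have "transpose M ** transpose A = mat 1"
    by (metis M(1) matrix_transpose_mul transpose_mat)
  ultimately have Mt: "transpose M *v n = N"
    by (metis matrix_vector_mul_assoc matrix_vector_mul_lid)
  have F: "F = A - outer N n" by (simp add: A_def)
  have FB: "F ** B = mat 1 - outer N N"
  proof -
    have "F ** B = A ** M - A ** outer n N - outer N n ** M + outer N n ** outer n N"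
      by (simp add: F B_def matrix_diff_ldistrib matrix_diff_rdistrib)
    then show ?thesis
      using \<open>A *v n = N\<close> Mt nn by (simp add: M mult_outer outer_mult)
  qed
  have BF: "B ** F = mat 1 - outer n n"
  proof -
    have "B ** F = M ** A - M ** outer N n - outer n N ** A + outer n N ** outer N n"
      by (simp add: F B_def matrix_diff_ldistrib matrix_diff_rdistrib)
    then show ?thesis
      using \<open>transpose A *v N = n\<close> Mn nn by (simp add: M mult_outer outer_mult)
  qed
  have "pseudo_inverse F = B"
  proof (rule pseudo_inverse_eqI)
    show "F ** B ** F = F"
      using N by (simp add: FB matrix_diff_rdistrib outer_mult) (simp add: outer_def vec_eq_iff)
    have "transpose B *v n = 0"
      using Mt nn by (simp add: B_def transpose_diff matrix_vector_mult_diff_rdistrib)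
    then show "B ** F ** B = B"
      by (simp add: BF matrix_diff_rdistrib outer_mult) (simp add: outer_def vec_eq_iff)
  qed (simp_all add: FB BF transpose_diff)
  then have "transpose (pseudo_inverse F) *v g = transpose M *v g"
    using g by (simp add: B_def transpose_diff matrix_vector_mult_diff_rdistrib inner_commute)
  moreover have "transpose A ** transpose M = mat 1"
    by (metis M(2) matrix_transpose_mul transpose_mat)
  ultimately show ?thesis
    by (metis A_def matrix_vector_mul_assoc matrix_vector_mul_lid)
qed

section \<open>Perturbations of the tangential projection\<close>

text \<open>As \<open>F n = 0\<close>, the determinant of \<open>F\<close> vanishes, and with it \<open>F\<^sup>T m = det(F) n\<close>. Adding \<open>n \<otimes> n\<close>
  completes \<open>F\<close> to \<open>I + J\<close>, whose determinant is therefore \<open>m \<bullet> n\<close>. This fixes the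
  orientation of the deformed normal and shows \<open>m \<noteq> 0\<close>.\<close>

lemma normal_of_perturbed_projection:
  fixes J :: "real^3^3"
  assumes n: "norm n = 1" "J *v n = 0" and pos: "det (mat 1 + J) > 0"
    and F: "F = tang_proj n + J" and N: "N = (1 / norm m) *\<^sub>R m" "m = cofactor_matrix F *v n"
  shows "norm N = 1" "transpose F *v N = 0" "N \<bullet> n > 0"
proof -
  have nn: "n \<bullet> n = 1" using n by (simp add: norm_eq_1)
  have "F *v n = 0" using n nn by (simp add: F matrix_vector_mult_add_rdistrib tang_proj_mult_vec)
  moreover have "n \<noteq> 0" using n by auto
  ultimately have "\<not> invertible F"
    unfolding invertible_left_inverse matrix_left_invertible_ker by (intro notI) simp
  then have det: "det F = 0" by (simp add: invertible_det_nz)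
  have "F + outer n n = mat 1 + J" by (simp add: F tang_proj_eq)
  then have mn: "m \<bullet> n > 0"
    using det_rank_one_update[of F n n] pos det by (simp add: N inner_commute)
  then have "m \<noteq> 0" by auto
  then show "norm N = 1" by (simp add: N)
  have "transpose F *v m = mat (det F) *v n"
    by (simp only: N matrix_vector_mul_assoc transpose_mult_cofactor)
  then have "transpose F *v m = 0"
    by (simp add: det mat_def matrix_vector_mult_def vec_eq_iff)
  then show "transpose F *v N = 0"
    by (simp add: N matrix_vector_mult_scaleR)
  show "N \<bullet> n > 0" using mn \<open>m \<noteq> 0\<close> by (simp add: N)
qed

text \<open>The displayed equation for \<open>N\<close> is an orthogonal decomposition, because \<open>J\<^sup>T N \<bullet> n = N \<bullet> J n = 0\<close>.
  Hence \<open>N \<bullet> n\<close> differs from 1 only to second order by Pythagoras. Using the resulting first-order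
  estimate of \<open>N - n\<close> once more inside \<open>J\<^sup>T N\<close> yields the second-order one.\<close>

lemma unit_kernel_vector_expansion:
  fixes J :: "real^'n^'n"
  assumes n: "norm n = 1" "J *v n = 0"
    and N: "norm N = 1" "N = (N \<bullet> n) *\<^sub>R n - transpose J *v N" "N \<bullet> n > 0"
    and J: "norm J \<le> 1"
  shows "norm (N - n) \<le> 2 * norm J" "norm (N - (n - transpose J *v n)) \<le> 3 * (norm J)\<^sup>2"
proof -
  define j c r where "j = norm J" and "c = N \<bullet> n" and "r = transpose J *v N"
  have j: "0 \<le> j" "j \<le> 1" using J by (auto simp: j_def)
  have nn: "n \<bullet> n = 1" "N \<bullet> N = 1" using n N by (simp_all add: norm_eq_1)
  have r: "norm r \<le> j"
    using norm_matrix_vector_le[of "transpose J" N] N by (simp add: r_def j_def)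
  have rn: "r \<bullet> n = 0" using n by (simp add: r_def inner_transpose_mult)
  have Nd: "N = c *\<^sub>R n - r" using N(2) by (simp add: c_def r_def)
  have "N \<bullet> N = c * c + r \<bullet> r"
    unfolding Nd using rn nn by (simp add: inner_diff_left inner_diff_right inner_commute)
  then have "c\<^sup>2 + (norm r)\<^sup>2 = 1" using nn by (simp add: power2_eq_square flip: power2_norm_eq_inner)
  then have c2: "1 - c\<^sup>2 \<le> j\<^sup>2" "c\<^sup>2 \<le> 1"
    using r power_mono[OF r, of 2] by auto (smt (verit) zero_le_power2)
  have c1: "c > 0" "c \<le> 1" using N c2 by (auto simp: c_def abs_square_le_1)
  \<comment> \<open>For \<open>0 < c \<le> 1\<close> this bounds \<open>1 - c\<close> by \<open>1 - c\<^sup>2\<close>; for negative \<open>c\<close>, where \<open>N\<close> is near \<open>- n\<close>, the claim fails.\<close>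
  have "c\<^sup>2 \<le> c" using c1 by (simp add: power2_eq_square mult_left_le)
  then have c: "\<bar>c - 1\<bar> \<le> j\<^sup>2" using c1 c2 by linarith
  have jj: "j\<^sup>2 \<le> j" using j by (simp add: power2_eq_square mult_left_le)
  have "N - n = (c - 1) *\<^sub>R n - r" by (subst Nd) (simp add: algebra_simps)
  then have "norm (N - n) \<le> \<bar>c - 1\<bar> + norm r"
    using norm_triangle_ineq4[of "(c - 1) *\<^sub>R n" r] n by simp
  then have 1: "norm (N - n) \<le> 2 * j" using c r jj by linarith
  then show "norm (N - n) \<le> 2 * norm J" by (simp add: j_def)
  have "N - (n - transpose J *v n) = (c - 1) *\<^sub>R n - transpose J *v (N - n)"
    by (subst Nd) (simp add: r_def algebra_simps matrix_vector_mult_diff_distrib)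
  then have "norm (N - (n - transpose J *v n)) \<le> \<bar>c - 1\<bar> + norm (transpose J *v (N - n))"
    using norm_triangle_ineq4[of "(c - 1) *\<^sub>R n" "transpose J *v (N - n)"] n by simp
  moreover have "norm (transpose J *v (N - n)) \<le> j * (2 * j)"
    using norm_matrix_vector_le[of "transpose J" "N - n"] mult_left_mono[OF 1 j(1)] by (simp add: j_def)
  then have "norm (transpose J *v (N - n)) \<le> 2 * j\<^sup>2" by (simp add: power2_eq_square)
  ultimately have "norm (N - (n - transpose J *v n)) \<le> j\<^sup>2 + 2 * j\<^sup>2"
    using c by (meson add_mono order_trans)
  also have "\<dots> = 3 * (norm J)\<^sup>2" by (simp add: j_def)
  finally show "norm (N - (n - transpose J *v n)) \<le> 3 * (norm J)\<^sup>2" .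
qed

text \<open>With \<open>A = F + N \<otimes> n\<close> one has \<open>A\<^sup>T = I + J\<^sup>T + n \<otimes> (N - n)\<close>. Its distance from the identity is at most
  \<open>3 |J|\<close>; the bound \<open>|J| \<le> 1/6\<close> makes this at most \<open>1/2\<close>, which gives both the
  invertibility of \<open>A\<close> and \<open>|w| \<le> 2 |g|\<close> for the solution of \<open>A\<^sup>T w = g\<close>.\<close>

lemma transpose_pseudo_inverse_expansion:
  fixes J :: "real^3^3"
  assumes n: "norm n = 1" "J *v n = 0" and F: "F = tang_proj n + J"
    and N: "norm N = 1" "transpose F *v N = 0" "norm (N - n) \<le> 2 * norm J"
    and J: "norm J \<le> 1/6" and g: "g \<bullet> n = 0"
  shows "norm (transpose (pseudo_inverse F) *v g - g) \<le> 6 * norm J * norm g"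
proof -
  define A where "A = F + outer N n"
  have At: "transpose A *v w - w = transpose J *v w + ((N - n) \<bullet> w) *\<^sub>R n" for w
    by (simp add: A_def F transpose_add matrix_vector_mult_add_rdistrib tang_proj_mult_vec
        algebra_simps)
  have bound: "norm (transpose A *v w - w) \<le> 3 * norm J * norm w" for w
  proof -
    have "norm (transpose A *v w - w) \<le> norm (transpose J *v w) + \<bar>(N - n) \<bullet> w\<bar>"
      unfolding At using norm_triangle_ineq[of "transpose J *v w" "((N - n) \<bullet> w) *\<^sub>R n"] n by simp
    moreover have "\<bar>(N - n) \<bullet> w\<bar> \<le> 2 * norm J * norm w"
      using Cauchy_Schwarz_ineq2[of "N - n" w] mult_right_mono[OF N(3) norm_ge_zero[of w]] by linarith
    ultimately show ?thesis using norm_matrix_vector_le[of "transpose J" w] by simp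
  qed
  have half: "3 * norm J * norm w \<le> norm w / 2" for w :: "real^3"
    using mult_right_mono[OF J norm_ge_zero[of w]] by simp
  have "w = 0" if "transpose A *v w = 0" for w
  proof -
    have "norm (transpose A *v w - w) \<le> norm w / 2" using order_trans[OF bound half] .
    then have "norm w \<le> norm w / 2" unfolding that by simp
    then show ?thesis using norm_ge_zero[of w] norm_eq_zero[of w] by linarith
  qed
  then have "invertible (transpose A)"
    using matrix_left_invertible_ker invertible_left_inverse by blast
  then have inv: "invertible (F + outer N n)"
    using transpose_invertible transpose_transpose unfolding A_def by metis
  have Fn: "F *v n = 0"
    using n by (simp add: F matrix_vector_mult_add_rdistrib tang_proj_mult_vec norm_eq_1)
  define w where "w = transpose (pseudo_inverse F) *v g"
  have w: "transpose A *v w = g"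
    unfolding A_def w_def by (rule transpose_pseudo_inverse_bordered) (use n N Fn inv g in auto)
  have 1: "norm (g - w) \<le> 3 * norm J * norm w" using bound[of w] w by simp
  then have "norm (g - w) \<le> norm w / 2" using half[of w] by linarith
  then have "norm w \<le> 2 * norm g" using norm_triangle_sub[of w g] by (simp add: norm_minus_commute)
  then have "3 * norm J * norm w \<le> 3 * norm J * (2 * norm g)" by (intro mult_left_mono) auto
  also have "\<dots> = 6 * norm J * norm g" by simp
  finally have "norm (g - w) \<le> 6 * norm J * norm g" by (rule order_trans[OF 1])
  then show ?thesis unfolding w_def norm_minus_commute[of _ g] .
qed

text \<open>Since \<open>P\<close> is a symmetric projection, the terms of the product \<open>F\<^sup>T F\<close> linear in \<open>J\<close> are \<open>P J\<close> and its
  transpose, i.e. twice the symmetric part.\<close>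

lemma green_strain_algebra:
  fixes J :: "real^3^3"
  assumes n: "norm n = 1"
  shows "(1/2) *\<^sub>R (transpose (tang_proj n + J) ** (tang_proj n + J) - tang_proj n)
    - sym_part (tang_proj n ** J) = (1/2) *\<^sub>R (transpose J ** J)"
proof -
  have nn: "n \<bullet> n = 1" using n by (simp add: norm_eq_1)
  have PP: "tang_proj n ** tang_proj n = tang_proj n"
    unfolding matrix_eq using nn
    by (simp add: tang_proj_mult_vec inner_diff_right flip: matrix_vector_mul_assoc)
  have "transpose (tang_proj n + J) ** (tang_proj n + J)
      = tang_proj n + tang_proj n ** J + transpose J ** tang_proj n + transpose J ** J"
    by (simp add: transpose_add matrix_add_ldistrib matrix_add_rdistrib PP)
  moreover have "transpose (tang_proj n ** J) = transpose J ** tang_proj n"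
    by (simp add: matrix_transpose_mul)
  ultimately show ?thesis
    by (simp add: sym_part_def scaleR_add_right)
qed

section \<open>Uniform order symbols\<close>

text \<open>The product with a principal filter is uniformity over \<open>T\<close>.\<close>

lemma order_eps_iff:
  "order_eps T k f \<longleftrightarrow> (\<exists>C\<ge>0. \<forall>\<^sub>F \<epsilon> in at_right 0. \<forall>x\<in>T. norm (f \<epsilon> x) \<le> C * \<epsilon> ^ k)"
proof -
  have prod: "(\<forall>\<^sub>F p in at_right 0 \<times>\<^sub>F principal T. P p) \<longleftrightarrow> (\<forall>\<^sub>F \<epsilon> in at_right 0. \<forall>x\<in>T. P (\<epsilon>, x))"
    for P :: "real \<times> 'a \<Rightarrow> bool"
    unfolding eventually_prod_filter eventually_principal
  proof safe
    fix Q R assume "eventually Q (at_right 0)" "Ball T R" "\<forall>\<epsilon> x. Q \<epsilon> \<longrightarrow> R x \<longrightarrow> P (\<epsilon>, x)"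
    then show "\<forall>\<^sub>F \<epsilon> in at_right 0. \<forall>x\<in>T. P (\<epsilon>, x)" by (auto elim: eventually_mono)
  next
    assume "\<forall>\<^sub>F \<epsilon> in at_right 0. \<forall>x\<in>T. P (\<epsilon>, x)"
    then show "\<exists>Q R. eventually Q (at_right 0) \<and> Ball T R \<and> (\<forall>\<epsilon> x. Q \<epsilon> \<longrightarrow> R x \<longrightarrow> P (\<epsilon>, x))"
      by (intro exI[of _ "\<lambda>\<epsilon>. \<forall>x\<in>T. P (\<epsilon>, x)"] exI[of _ "\<lambda>x. x \<in> T"]) auto
  qed
  have pos: "\<forall>\<^sub>F \<epsilon> in at_right (0::real). \<epsilon> > 0" by (rule eventually_at_right_less)
  show ?thesis
  proof
    assume "order_eps T k f"
    then obtain C where "C > 0"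
      "\<forall>\<^sub>F p in at_right 0 \<times>\<^sub>F principal T. norm (norm (f (fst p) (snd p))) \<le> C * norm (fst p ^ k)"
      unfolding order_eps_def by (auto simp: bigo_def case_prod_unfold)
    then have "\<forall>\<^sub>F \<epsilon> in at_right 0. \<forall>x\<in>T. norm (f \<epsilon> x) \<le> C * norm (\<epsilon> ^ k)"
      by (simp add: prod)
    with pos have "\<forall>\<^sub>F \<epsilon> in at_right 0. \<forall>x\<in>T. norm (f \<epsilon> x) \<le> C * \<epsilon> ^ k"
      by eventually_elim auto
    with \<open>C > 0\<close> show "\<exists>C\<ge>0. \<forall>\<^sub>F \<epsilon> in at_right 0. \<forall>x\<in>T. norm (f \<epsilon> x) \<le> C * \<epsilon> ^ k"
      by (intro exI[of _ C]) auto
  next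
    assume "\<exists>C\<ge>0. \<forall>\<^sub>F \<epsilon> in at_right 0. \<forall>x\<in>T. norm (f \<epsilon> x) \<le> C * \<epsilon> ^ k"
    then obtain C where "\<forall>\<^sub>F \<epsilon> in at_right 0. \<forall>x\<in>T. norm (f \<epsilon> x) \<le> C * \<epsilon> ^ k" by blast
    with pos have "\<forall>\<^sub>F \<epsilon> in at_right 0. \<forall>x\<in>T. norm (f \<epsilon> x) \<le> C * norm (\<epsilon> ^ k)"
      by eventually_elim auto
    then show "order_eps T k f"
      unfolding order_eps_def by (intro bigoI[of _ C]) (simp add: prod case_prod_unfold)
  qed
qed

lemma order_eps_mono:
  assumes "order_eps T k g" "c \<ge> 0"
    and le: "\<forall>\<^sub>F \<epsilon> in at_right 0. \<forall>x\<in>T. norm (f \<epsilon> x) \<le> c * norm (g \<epsilon> x)"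
  shows "order_eps T k f"
proof -
  obtain C where "C \<ge> 0" and C: "\<forall>\<^sub>F \<epsilon> in at_right 0. \<forall>x\<in>T. norm (g \<epsilon> x) \<le> C * \<epsilon> ^ k"
    using assms(1) unfolding order_eps_iff by blast
  have "\<forall>\<^sub>F \<epsilon> in at_right 0. \<forall>x\<in>T. norm (f \<epsilon> x) \<le> (c * C) * \<epsilon> ^ k"
    using C le
  proof eventually_elim
    case (elim \<epsilon>)
    show ?case
    proof
      fix x assume "x \<in> T"
      have "norm (f \<epsilon> x) \<le> c * norm (g \<epsilon> x)" using elim \<open>x \<in> T\<close> by blast
      also have "\<dots> \<le> c * (C * \<epsilon> ^ k)" using elim \<open>x \<in> T\<close> assms(2) by (intro mult_left_mono) auto
      finally show "norm (f \<epsilon> x) \<le> (c * C) * \<epsilon> ^ k" by (simp add: mult.assoc)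
    qed
  qed
  then show ?thesis unfolding order_eps_iff using assms(2) \<open>C \<ge> 0\<close> by (intro exI[of _ "c * C"]) auto
qed

text \<open>Shrinking the range of the parameter to \<open>\<epsilon> < 1\<close> makes the higher power the smaller one.\<close>

lemma order_eps_SucD:
  assumes "order_eps T (Suc k) f"
  shows "order_eps T k f"
proof -
  obtain C where "C \<ge> 0" and C: "\<forall>\<^sub>F \<epsilon> in at_right 0. \<forall>x\<in>T. norm (f \<epsilon> x) \<le> C * \<epsilon> ^ Suc k"
    using assms unfolding order_eps_iff by blast
  have "\<forall>\<^sub>F \<epsilon> in at_right (0::real). \<epsilon> < 1"
    by (rule eventually_at_right_real[of 0 1, THEN eventually_mono]) auto
  with C eventually_at_right_less[of 0]
  have "\<forall>\<^sub>F \<epsilon> in at_right 0. \<forall>x\<in>T. norm (f \<epsilon> x) \<le> C * \<epsilon> ^ k"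
  proof eventually_elim
    case (elim \<epsilon>)
    then have "C * \<epsilon> ^ Suc k \<le> C * \<epsilon> ^ k"
      using \<open>C \<ge> 0\<close> by (intro mult_left_mono power_decreasing) auto
    then show ?case using elim by (blast intro: order_trans)
  qed
  then show ?thesis unfolding order_eps_iff using \<open>C \<ge> 0\<close> by blast
qed

lemma order_eps_add:
  assumes "order_eps T k f" "order_eps T k g"
  shows "order_eps T k (\<lambda>\<epsilon> x. f \<epsilon> x + g \<epsilon> x)"
proof -
  obtain C D where "C \<ge> 0" and C: "\<forall>\<^sub>F \<epsilon> in at_right 0. \<forall>x\<in>T. norm (f \<epsilon> x) \<le> C * \<epsilon> ^ k"
    and "D \<ge> 0" and D: "\<forall>\<^sub>F \<epsilon> in at_right 0. \<forall>x\<in>T. norm (g \<epsilon> x) \<le> D * \<epsilon> ^ k"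
    using assms unfolding order_eps_iff by blast
  from C D have "\<forall>\<^sub>F \<epsilon> in at_right 0. \<forall>x\<in>T. norm (f \<epsilon> x + g \<epsilon> x) \<le> (C + D) * \<epsilon> ^ k"
    by eventually_elim (simp add: distrib_right norm_triangle_mono)
  then show ?thesis unfolding order_eps_iff using \<open>C \<ge> 0\<close> \<open>D \<ge> 0\<close> by (intro exI[of _ "C + D"]) auto
qed

lemma order_eps_sum:
  assumes "\<And>i. i \<in> I \<Longrightarrow> order_eps T k (f i)"
  shows "order_eps T k (\<lambda>\<epsilon> x. \<Sum>i\<in>I. f i \<epsilon> x)"
  using assms
proof (induction I rule: infinite_finite_induct)
  case (insert i I)
  then show ?case by (simp add: order_eps_add)
qed (auto simp: order_eps_iff intro: exI[of _ 0])

lemma order_eps_mult: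
  assumes "order_eps T k f" "order_eps T l g"
  shows "order_eps T (k + l) (\<lambda>\<epsilon> x. norm (f \<epsilon> x) * norm (g \<epsilon> x))"
proof -
  obtain C D where "C \<ge> 0" and C: "\<forall>\<^sub>F \<epsilon> in at_right 0. \<forall>x\<in>T. norm (f \<epsilon> x) \<le> C * \<epsilon> ^ k"
    and "D \<ge> 0" and D: "\<forall>\<^sub>F \<epsilon> in at_right 0. \<forall>x\<in>T. norm (g \<epsilon> x) \<le> D * \<epsilon> ^ l"
    using assms unfolding order_eps_iff by blast
  from C D eventually_at_right_less[of 0]
  have "\<forall>\<^sub>F \<epsilon> in at_right 0. \<forall>x\<in>T. norm (norm (f \<epsilon> x) * norm (g \<epsilon> x)) \<le> (C * D) * \<epsilon> ^ (k + l)"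
  proof eventually_elim
    case (elim \<epsilon>)
    show ?case
    proof
      fix x assume "x \<in> T"
      then have "norm (f \<epsilon> x) * norm (g \<epsilon> x) \<le> (C * \<epsilon> ^ k) * (D * \<epsilon> ^ l)"
        using elim \<open>C \<ge> 0\<close> by (intro mult_mono) auto
      then show "norm (norm (f \<epsilon> x) * norm (g \<epsilon> x)) \<le> (C * D) * \<epsilon> ^ (k + l)"
        by (simp add: power_add ac_simps)
    qed
  qed
  then show ?thesis unfolding order_eps_iff using \<open>C \<ge> 0\<close> \<open>D \<ge> 0\<close> by (intro exI[of _ "C * D"]) auto
qed

lemma order_eps_eventually_less:
  assumes "order_eps T 1 f" "d > 0"
  shows "\<forall>\<^sub>F \<epsilon> in at_right 0. \<forall>x\<in>T. norm (f \<epsilon> x) < d"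
proof -
  obtain C where "C \<ge> 0" and C: "\<forall>\<^sub>F \<epsilon> in at_right 0. \<forall>x\<in>T. norm (f \<epsilon> x) \<le> C * \<epsilon> ^ 1"
    using assms(1) unfolding order_eps_iff by blast
  have "((\<lambda>\<epsilon>. C * \<epsilon>) \<longlongrightarrow> C * 0) (at_right 0)" by (intro tendsto_intros)
  then have "\<forall>\<^sub>F \<epsilon> in at_right 0. C * \<epsilon> < d" using assms(2) by (auto dest: order_tendstoD)
  with C show ?thesis by eventually_elim (auto intro: le_less_trans)
qed

section \<open>Smooth extensions\<close>

text \<open>On an open set the derivatives depend only on the values there. This lets the next two lemmas replace
  a derivative by its formula, which is known on \<open>U\<close> only.\<close>

lemma Ck_on_cong:
  assumes "open U" "Ck_on k f U" "\<And>x. x \<in> U \<Longrightarrow> f x = g x"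
  shows "Ck_on k g U"
  using assms(2,3)
proof (induction k arbitrary: f g)
  case 0
  then show ?case by (auto cong: continuous_on_cong)
next
  case (Suc k)
  have d: "(g has_derivative frechet_derivative f (at x)) (at x)" if "x \<in> U" for x
    using Suc.prems that \<open>open U\<close> frechet_derivative_works has_derivative_transform_within_open
    by (metis Ck_on.simps(2))
  have "Ck_on k (\<lambda>x. frechet_derivative g (at x) h) U" for h
  proof (rule Suc.IH)
    show "Ck_on k (\<lambda>x. frechet_derivative f (at x) h) U"
      using Suc.prems by simp
    show "frechet_derivative f (at x) h = frechet_derivative g (at x) h" if "x \<in> U" for x
      using frechet_derivative_at[OF d[OF that]] by simp
  qed
  then show ?case
    using d by (auto simp: differentiable_def)
qed

lemma Ck_on_add:
  assumes "open U" "Ck_on k f U" "Ck_on k g U"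
  shows "Ck_on k (\<lambda>x. f x + g x) U"
  using assms(2,3)
proof (induction k arbitrary: f g)
  case 0
  then show ?case by (auto intro: continuous_on_add)
next
  case (Suc k)
  have d: "((\<lambda>x. f x + g x) has_derivative
      (\<lambda>h. frechet_derivative f (at x) h + frechet_derivative g (at x) h)) (at x)" if "x \<in> U" for x
    using Suc.prems that by (intro has_derivative_add) (auto simp: frechet_derivative_works[symmetric])
  have "Ck_on k (\<lambda>x. frechet_derivative (\<lambda>x. f x + g x) (at x) h) U" for h
  proof (rule Ck_on_cong[OF \<open>open U\<close>])
    show "Ck_on k (\<lambda>x. frechet_derivative f (at x) h + frechet_derivative g (at x) h) U"
      using Suc.prems by (intro Suc.IH) auto
    show "frechet_derivative f (at x) h + frechet_derivative g (at x) h
        = frechet_derivative (\<lambda>x. f x + g x) (at x) h" if "x \<in> U" for x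
      by (simp add: frechet_derivative_at[OF d[OF that], symmetric])
  qed
  then show ?case
    using d by (auto simp: differentiable_def)
qed

lemma Ck_on_bounded_linear_compose:
  assumes "open U" "bounded_linear L" "Ck_on k f U"
  shows "Ck_on k (\<lambda>x. L (f x)) U"
  using assms(3)
proof (induction k arbitrary: f)
  case 0
  then show ?case
    using bounded_linear.continuous_on[OF assms(2)] by simp
next
  case (Suc k)
  have d: "((\<lambda>x. L (f x)) has_derivative (\<lambda>h. L (frechet_derivative f (at x) h))) (at x)"
    if "x \<in> U" for x
    using Suc.prems that
    by (intro bounded_linear.has_derivative[OF assms(2)]) (auto simp: frechet_derivative_works[symmetric])
  have "Ck_on k (\<lambda>x. frechet_derivative (\<lambda>x. L (f x)) (at x) h) U" for h
  proof (rule Ck_on_cong[OF \<open>open U\<close>])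
    show "Ck_on k (\<lambda>x. L (frechet_derivative f (at x) h)) U"
      using Suc.prems by (intro Suc.IH) auto
    show "L (frechet_derivative f (at x) h) = frechet_derivative (\<lambda>x. L (f x)) (at x) h"
      if "x \<in> U" for x
      by (simp add: frechet_derivative_at[OF d[OF that], symmetric])
  qed
  then show ?case
    using d by (auto simp: differentiable_def)
qed

lemma Ck_on_const: "Ck_on k (\<lambda>x. c) U"
  by (induction k arbitrary: c) simp_all

lemma Ck_on_bounded_linear: "Ck_on k L U" if "bounded_linear L"
proof (cases k)
  case 0
  then show ?thesis
    using that by (simp add: linear_continuous_on)
next
  case (Suc k')
  have "frechet_derivative L (at x) = L" for x
    using frechet_derivative_at bounded_linear_imp_has_derivative[OF that] by metis
  then show ?thesis
    using Suc bounded_linear_imp_differentiable[OF that] by (simp add: Ck_on_const)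
qed

lemma smooth_onD:
  assumes "smooth_on W G" "x \<in> W"
  shows "G differentiable (at x)"
proof -
  have "Ck_on (Suc 0) G W"
    using assms by (simp add: smooth_on_def del: Ck_on.simps)
  then show ?thesis using assms by simp
qed

lemma smooth_on_continuous:
  assumes "smooth_on W G"
  shows "continuous_on W G"
  using assms unfolding smooth_on_def by (metis Ck_on.simps(1))

lemma smooth_on_continuous_derivative:
  assumes "smooth_on W G"
  shows "continuous_on W (\<lambda>x. frechet_derivative G (at x) h)"
proof -
  have "Ck_on (Suc 0) G W"
    using assms by (simp add: smooth_on_def del: Ck_on.simps)
  then show ?thesis by simp
qed

lemma smooth_extension_differentiable:
  assumes "smooth_extension T f G" "x \<in> T"
  shows "G differentiable (at x)"
  using assms smooth_onD unfolding smooth_extension_def by blast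

lemma smooth_extension_component:
  fixes v :: "'a::real_normed_vector \<Rightarrow> real^'n"
  assumes "smooth_extension T v G"
  shows "smooth_extension T (\<lambda>y. v y $ i) (\<lambda>y. G y $ i)"
proof -
  obtain W where "open W" "T \<subseteq> W" "\<forall>k. Ck_on k G W" "\<forall>y\<in>T. G y = v y"
    using assms unfolding smooth_extension_def smooth_on_def by blast
  then show ?thesis
    using Ck_on_bounded_linear_compose[OF \<open>open W\<close> bounded_linear_vec_nth, of _ G i]
    unfolding smooth_extension_def smooth_on_def by (intro exI[of _ W]) simp
qed

text \<open>Supplies an extension of the components of the deformation.\<close>

lemma smooth_extension_coordinate_add:
  fixes f :: "real^'n \<Rightarrow> real"
  assumes "smooth_extension T f G"
  shows "smooth_extension T (\<lambda>y. y $ i + f y) (\<lambda>y. y $ i + G y)"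
proof -
  obtain W where "open W" "T \<subseteq> W" "\<forall>k. Ck_on k G W" "\<forall>y\<in>T. G y = f y"
    using assms unfolding smooth_extension_def smooth_on_def by blast
  then show ?thesis
    using Ck_on_add[OF \<open>open W\<close> Ck_on_bounded_linear[OF bounded_linear_vec_nth], of _ G i]
    unfolding smooth_extension_def smooth_on_def by (intro exI[of _ W]) simp
qed

section \<open>Surface gradients\<close>

lemma has_derivative_gradient:
  assumes "G differentiable (at x)"
  shows "(G has_derivative (\<lambda>v. gradient G x \<bullet> v)) (at x)"
proof -
  let ?D = "frechet_derivative G (at x)"
  have lin: "linear ?D" using assms by (rule linear_frechet_derivative)
  have "?D v = gradient G x \<bullet> v" for v
  proof -
    have "?D v = ?D (\<Sum>i\<in>UNIV. v $ i *\<^sub>R axis i 1)"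
      by (simp add: basis_expansion flip: scalar_mult_eq_scaleR)
    also have "\<dots> = (\<Sum>i\<in>UNIV. v $ i * ?D (axis i 1))"
      using lin by (simp add: linear_sum linear_cmul)
    finally show ?thesis
      by (simp add: gradient_def inner_vec_def mult.commute)
  qed
  then have "?D = (\<lambda>v. gradient G x \<bullet> v)" by blast
  then show ?thesis using assms by (metis frechet_derivative_works)
qed

lemma gradient_add:
  assumes "G differentiable (at x)" "H differentiable (at x)"
  shows "gradient (\<lambda>y. G y + H y) x = gradient G x + gradient H x"
proof -
  have "((\<lambda>y. G y + H y) has_derivative
      (\<lambda>h. frechet_derivative G (at x) h + frechet_derivative H (at x) h)) (at x)"
    using assms by (intro has_derivative_add) (auto simp: frechet_derivative_works[symmetric])
  from frechet_derivative_at[OF this, symmetric] show ?thesis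
    by (simp add: gradient_def vec_eq_iff)
qed

lemma gradient_coordinate: "gradient (\<lambda>y. y $ i) x = axis i 1"
proof -
  have "((\<lambda>y::real^3. y $ i) has_derivative (\<lambda>h. h $ i)) (at x)"
    by (rule bounded_linear_imp_has_derivative) (rule bounded_linear_vec_nth)
  from frechet_derivative_at[OF this, symmetric] show ?thesis
    by (auto simp: gradient_def vec_eq_iff axis_def)
qed

text \<open>A one-sided derivative along the segment from \<open>s\<close> to \<open>t\<close> is enough, so \<open>s\<close> may lie on the boundary
  of \<open>K\<close>, even in a corner, where no full line through \<open>s\<close> stays in \<open>K\<close>.\<close>

lemma linear_zero_on_tangent_cone:
  assumes D: "(f has_derivative D) (at s)" and K: "convex K" "s \<in> K" "t \<in> K"
    and zero: "\<And>r. r \<in> K \<Longrightarrow> f r = 0"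
  shows "D (t - s) = 0"
proof -
  let ?l = "\<lambda>r::real. s + r *\<^sub>R (t - s)"
  have l: "(?l has_vector_derivative (t - s)) (at 0 within {0..1})"
    by (auto intro!: derivative_eq_intros simp: has_vector_derivative_def)
  have "((f \<circ> ?l) has_vector_derivative D (t - s)) (at 0 within cbox 0 1)"
    using vector_derivative_diff_chain_within[OF l, of f D] D
    by (simp add: has_derivative_at_withinI)
  moreover have "((f \<circ> ?l) has_vector_derivative 0) (at 0 within cbox 0 1)"
  proof (rule has_vector_derivative_transform[of _ _ _ "\<lambda>_. 0"])
    fix r :: real assume "r \<in> cbox 0 1"
    then have "(1 - r) *\<^sub>R s + r *\<^sub>R t \<in> K"
      using K by (intro convexD_alt) auto
    moreover have "?l r = (1 - r) *\<^sub>R s + r *\<^sub>R t" by (simp add: algebra_simps)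
    ultimately show "(f \<circ> ?l) r = 0" using zero by (metis comp_apply)
  qed auto
  ultimately show ?thesis
    by (rule vector_derivative_unique_within_closed_interval[rotated 2]) auto
qed

lemma reference_corners:
  assumes "elem_chart T cs X"
  shows "{0, axis 1 1, axis 2 1} \<subseteq> convex hull set cs"
proof -
  have "{0, axis 1 1, axis 2 1} \<subseteq> set cs"
    using assms by (auto simp: elem_chart_def tri_corners_def quad_corners_def)
  then show ?thesis using hull_subset[of "set cs" convex] by (rule order_trans)
qed

lemma linear_real2_eq_0:
  assumes "linear D" "D (axis 1 1) = 0" "D (axis 2 1) = 0"
  shows "D (h::real^2) = 0"
proof -
  have "h = (\<Sum>i\<in>UNIV. h $ i *\<^sub>R axis i 1)"
    by (simp add: basis_expansion flip: scalar_mult_eq_scaleR)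
  then have "D h = D (h $ 1 *\<^sub>R axis 1 1 + h $ 2 *\<^sub>R axis 2 1)"
    by (simp add: sum_2)
  with assms show ?thesis by (simp add: linear_add linear_cmul)
qed

text \<open>The orthogonal complement of the two-dimensional image of \<open>L\<close> in three-space is a line.\<close>

lemma orthogonal_to_plane_parallel:
  fixes L :: "real^2 \<Rightarrow> real^3"
  assumes L: "linear L" "inj L" and n: "n \<noteq> 0" "\<And>h. n \<bullet> L h = 0" and z: "\<And>h. z \<bullet> L h = 0"
  shows "\<exists>c. z = c *\<^sub>R n"
proof -
  let ?N = "{y \<in> UNIV. \<forall>x\<in>range L. orthogonal x y}"
  have "subspace (range L)" using L(1) by (simp add: linear_subspace_image)
  then have "dim ?N + dim (range L) = dim (UNIV :: (real^3) set)"
    by (intro dim_subspace_orthogonal_to_vectors) auto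
  moreover have "dim (range L) = 2"
    using dim_image_eq[OF L(1), of UNIV] L(2) by simp
  ultimately have "dim ?N = 1" by simp
  moreover have "n \<in> ?N" "z \<in> ?N"
    using n z by (auto simp: orthogonal_def inner_commute)
  moreover have "subspace ?N" by (auto simp: subspace_def orthogonal_def inner_add_right)
  ultimately have "span {n} = ?N"
    using dim_eq_span[of "{n}" ?N] \<open>n \<noteq> 0\<close> by (simp add: span_eq_iff[THEN iffD2])
  then have "z \<in> span {n}" using \<open>z \<in> ?N\<close> by simp
  then show ?thesis by (auto simp: span_singleton)
qed

text \<open>Every extension gives the same surface gradient, so the arbitrary choice in the definition is
  harmless. The difference of two extensions vanishes on the element. Pulled back by the chart, its
  derivative vanishes in the directions from \<open>s\<close> to the corners of the reference element. These span
  the plane, hence the difference of the gradients is orthogonal to the tangent plane, i.e. parallel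
  to the normal, and the projection removes it.\<close>

lemma surf_grad_eq:
  assumes T: "curved_element T" and n: "unit_normal T n"
    and G: "smooth_extension T f G" and "x \<in> T"
  shows "surf_grad T n f x = tang_proj (n x) *v gradient G x"
proof -
  define H where "H = (SOME G. smooth_extension T f G)"
  have H: "smooth_extension T f H" using someI_ex[of "smooth_extension T f"] G unfolding H_def by blast
  obtain cs X where ch: "elem_chart T cs X" using T unfolding curved_element_def by blast
  let ?K = "convex hull set cs"
  obtain s where s: "s \<in> ?K" "x = X s" using ch \<open>x \<in> T\<close> by (auto simp: elem_chart_def)
  let ?L = "frechet_derivative X (at s)"
  have X: "X differentiable (at s)" using ch s smooth_onD unfolding elem_chart_def by blast
  have dG: "G differentiable (at x)" "H differentiable (at x)"
    using smooth_extension_differentiable[OF _ \<open>x \<in> T\<close>] G H by auto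
  let ?z = "gradient H x - gradient G x"
  let ?D = "\<lambda>h. ?z \<bullet> ?L h"
  have "((\<lambda>y. H y - G y) has_derivative (\<lambda>v. ?z \<bullet> v)) (at (X s))"
    using has_derivative_diff[OF dG(2,1)[THEN has_derivative_gradient]] s
    by (simp add: inner_diff_left)
  then have der: "((\<lambda>y. H y - G y) \<circ> X has_derivative ?D) (at s)"
    using diff_chain_at[OF X[unfolded frechet_derivative_works]] by (simp add: o_def)
  have zero: "((\<lambda>y. H y - G y) \<circ> X) r = 0" if "r \<in> ?K" for r
    using that ch G H by (auto simp: elem_chart_def smooth_extension_def)
  have lin: "linear ?D" using der has_derivative_bounded_linear bounded_linear.linear by blast
  have cone: "?D t = ?D s" if "t \<in> ?K" for t
    using linear_zero_on_tangent_cone[OF der convex_convex_hull s(1) that zero] linear_diff[OF lin, of t s]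
    by simp
  have K: "0 \<in> ?K" "axis 1 1 \<in> ?K" "axis 2 1 \<in> ?K" using reference_corners[OF ch] by auto
  have "?D s = 0" using cone[OF K(1)] linear_0[OF lin] by simp
  then have "?D (axis 1 1) = 0" "?D (axis 2 1) = 0" using cone K by simp_all
  then have z: "?z \<bullet> ?L h = 0" for h
    using linear_real2_eq_0[OF lin] by blast
  have nL: "n x \<bullet> ?L h = 0" for h
    using n ch s \<open>x \<in> T\<close> unfolding unit_normal_def tangent_vector_def by blast
  have n1: "norm (n x) = 1" using n \<open>x \<in> T\<close> by (simp add: unit_normal_def)
  have "\<exists>c. ?z = c *\<^sub>R n x"
  proof (rule orthogonal_to_plane_parallel[of ?L])
    show "linear ?L" using X by (rule linear_frechet_derivative)
    show "inj ?L" using ch s by (auto simp: elem_chart_def)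
  qed (use n1 z nL in auto)
  then have "tang_proj (n x) *v ?z = 0"
    using n1 by (auto simp: tang_proj_mult_vec norm_eq_1)
  then show ?thesis
    by (simp add: surf_grad_def H_def matrix_vector_mult_diff_distrib)
qed

text \<open>The coordinate functions are their own smooth extensions, with gradients the unit vectors; these
  contribute the rows of the symmetric matrix \<open>P\<close>.\<close>

lemma def_grad_eq:
  assumes T: "curved_element T" "unit_normal T n" and u: "elem_smooth T u" and "x \<in> T"
  shows "def_grad T n u x = tang_proj (n x) + surf_jac T n u x"
proof -
  obtain G where G: "smooth_extension T u G" using u unfolding elem_smooth_def by blast
  have row: "surf_grad T n (\<lambda>y. (y + u y) $ i) x = tang_proj (n x) $ i + surf_grad T n (\<lambda>y. u y $ i) x"
    for i
  proof -
    have Gi: "smooth_extension T (\<lambda>y. u y $ i) (\<lambda>y. G y $ i)"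
      using G by (rule smooth_extension_component)
    have "surf_grad T n (\<lambda>y. (y + u y) $ i) x = tang_proj (n x) *v gradient (\<lambda>y. y $ i + G y $ i) x"
      using surf_grad_eq[OF T smooth_extension_coordinate_add[OF Gi] \<open>x \<in> T\<close>] by simp
    also have "gradient (\<lambda>y. y $ i + G y $ i) x = axis i 1 + gradient (\<lambda>y. G y $ i) x"
      using smooth_extension_differentiable[OF Gi \<open>x \<in> T\<close>]
      by (simp add: gradient_add gradient_coordinate bounded_linear_imp_differentiable
          bounded_linear_vec_nth)
    also have "tang_proj (n x) *v (axis i 1 + gradient (\<lambda>y. G y $ i) x)
        = tang_proj (n x) $ i + surf_grad T n (\<lambda>y. u y $ i) x"
      using surf_grad_eq[OF T Gi \<open>x \<in> T\<close>] transpose_tang_proj[of "n x"]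
      by (simp add: matrix_vector_right_distrib matrix_vector_mult_basis column_def
          transpose_def vec_eq_iff)
    finally show ?thesis .
  qed
  then show ?thesis
    by (simp add: def_grad_def surf_jac_def vec_eq_iff)
qed

lemma surf_jac_normal:
  assumes "unit_normal T n" "x \<in> T"
  shows "surf_jac T n v x *v n x = 0"
proof -
  have "n x \<bullet> n x = 1" using assms by (simp add: unit_normal_def norm_eq_1)
  then have "(tang_proj (n x) *v z) \<bullet> n x = 0" for z
    using inner_commute[of z "n x"] by (simp add: tang_proj_mult_vec inner_diff_left)
  then show ?thesis
    by (simp add: surf_jac_def surf_grad_def vec_eq_iff matrix_mult_dot)
qed

text \<open>The element is compact as a continuous image of the reference element, and the gradient of a smooth
  extension is continuous up to the boundary.\<close>

lemma bounded_surf_jac: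
  assumes T: "curved_element T" "unit_normal T n" and v: "elem_smooth T v"
  shows "bounded (surf_jac T n v ` T)"
proof -
  obtain cs X where ch: "elem_chart T cs X" using T unfolding curved_element_def by blast
  obtain W where "convex hull set cs \<subseteq> W" "smooth_on W X"
    using ch unfolding elem_chart_def by blast
  then have "continuous_on (convex hull set cs) X"
    using smooth_on_continuous continuous_on_subset by blast
  then have cpt: "compact T"
    using ch by (auto simp: elem_chart_def intro!: compact_continuous_image finite_imp_compact_convex_hull)
  obtain G where G: "smooth_extension T v G" using v unfolding elem_smooth_def by blast
  obtain N where N: "smooth_extension T n N"
    using T unfolding unit_normal_def elem_smooth_def by blast
  have cN: "continuous_on T n"
  proof -
    obtain W where "T \<subseteq> W" "smooth_on W N" and eq: "\<And>y. y \<in> T \<Longrightarrow> N y = n y"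
      using N unfolding smooth_extension_def by blast
    then have "continuous_on T N"
      using smooth_on_continuous continuous_on_subset by blast
    then show ?thesis using eq continuous_on_cong[of T T N n] by simp
  qed
  have cg: "continuous_on T (gradient (\<lambda>y. G y $ i))" for i
  proof -
    obtain W where "T \<subseteq> W" "smooth_on W (\<lambda>y. G y $ i)"
      using smooth_extension_component[OF G] unfolding smooth_extension_def by metis
    then show ?thesis
      unfolding gradient_def
      by (intro continuous_on_vec_lambda) (blast intro: continuous_on_subset smooth_on_continuous_derivative)
  qed
  have "surf_jac T n v x =
      (\<chi> i. gradient (\<lambda>y. G y $ i) x - (n x \<bullet> gradient (\<lambda>y. G y $ i) x) *\<^sub>R n x)" if "x \<in> T" for x
    using surf_grad_eq[OF T smooth_extension_component[OF G] that]
    by (simp add: surf_jac_def tang_proj_mult_vec)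
  moreover have "continuous_on T
      (\<lambda>x. \<chi> i. gradient (\<lambda>y. G y $ i) x - (n x \<bullet> gradient (\<lambda>y. G y $ i) x) *\<^sub>R n x)"
    by (intro continuous_on_vec_lambda continuous_intros cg cN)
  ultimately have "continuous_on T (surf_jac T n v)"
    by (auto cong: continuous_on_cong)
  then show ?thesis
    using cpt compact_continuous_image compact_imp_bounded by blast
qed

section \<open>Expansions of the shell quantities\<close>

lemma director_expansion:
  assumes T: "curved_element T" "unit_normal T n" and u: "elem_smooth T u" and x: "x \<in> T"
    and g: "g x \<bullet> n x = 0"
    and J: "norm (surf_jac T n u x) \<le> 1/6" "det (mat 1 + surf_jac T n u x) > 0"
  shows "norm (director T n u g x - (n x - transpose (surf_jac T n u x) *v n x + g x))
    \<le> 3 * (norm (surf_jac T n u x))\<^sup>2 + 6 * norm (surf_jac T n u x) * norm (g x)"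
proof -
  define J F m N where "J = surf_jac T n u x" and "F = tang_proj (n x) + J"
    and "m = cofactor_matrix F *v n x" and "N = (1 / norm m) *\<^sub>R m"
  have n: "norm (n x) = 1" "J *v n x = 0"
    using T x surf_jac_normal[OF T(2) x] by (auto simp: unit_normal_def J_def)
  have Jb: "norm J \<le> 1/6" "det (mat 1 + J) > 0" using J by (simp_all add: J_def)
  have N: "norm N = 1" "transpose F *v N = 0" "N \<bullet> n x > 0"
    using normal_of_perturbed_projection[OF n Jb(2) F_def N_def m_def] .
  have "N - (n x \<bullet> N) *\<^sub>R n x + transpose J *v N = 0"
    using N(2) by (simp add: F_def transpose_add matrix_vector_mult_add_rdistrib tang_proj_mult_vec)
  then have N_eq: "N = (N \<bullet> n x) *\<^sub>R n x - transpose J *v N"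
    by (simp add: inner_commute add_eq_0_iff algebra_simps)
  have J1: "norm J \<le> 1" using Jb by simp
  note exp = unit_kernel_vector_expansion[OF n N(1) N_eq N(3) J1]
  have pinv: "norm (transpose (pseudo_inverse F) *v g x - g x) \<le> 6 * norm J * norm (g x)"
    by (rule transpose_pseudo_inverse_expansion[OF n F_def N(1,2) exp(1) Jb(1) g])
  have "def_grad T n u x = F"
    using def_grad_eq[OF T u x] by (simp add: F_def J_def)
  then have "director T n u g x = N + transpose (pseudo_inverse F) *v g x"
    by (simp add: director_def deformed_normal_def Let_def N_def m_def)
  then have "director T n u g x - (n x - transpose J *v n x + g x)
      = (N - (n x - transpose J *v n x)) + (transpose (pseudo_inverse F) *v g x - g x)"
    by simp
  then show ?thesis
    using norm_triangle_mono[OF exp(2) pinv] by (simp only: J_def)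
qed

lemma green_strain_expansion:
  assumes T: "curved_element T" "unit_normal T n" and u: "elem_smooth T u" and x: "x \<in> T"
  shows "green_strain T n u x - sym_part (surf_cov T n u x)
    = (1/2) *\<^sub>R (transpose (surf_jac T n u x) ** surf_jac T n u x)"
proof -
  have "norm (n x) = 1" using T x by (simp add: unit_normal_def)
  then show ?thesis
    by (simp add: green_strain_algebra green_strain_def surf_cov_def def_grad_eq[OF T u x])
qed

lemma hess_contr_diff:
  "hess_contr T n u v x - hess_contr T n u w x
    = (\<Sum>i\<in>UNIV. (v x - w x) $ i *\<^sub>R surf_hess T n (\<lambda>y. u y $ i) x)"
  by (simp add: hess_contr_def scaleR_left_diff_distrib sum_subtractf)

lemma norm_hess_contr_diff_le:
  "norm (hess_contr T n u v x - hess_contr T n u w x)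
    \<le> (\<Sum>i\<in>UNIV. norm (v x - w x) * norm (surf_hess T n (\<lambda>y. u y $ i) x))"
proof -
  have "norm ((v x - w x) $ i *\<^sub>R surf_hess T n (\<lambda>y. u y $ i) x)
      \<le> norm (v x - w x) * norm (surf_hess T n (\<lambda>y. u y $ i) x)" for i
    using mult_right_mono[OF component_le_norm_cart[of "v x - w x" i] norm_ge_zero] by simp
  then show ?thesis
    unfolding hess_contr_diff by (intro norm_sum[THEN order_trans] sum_mono)
qed

theorem lemma5p1:
  fixes \<T> :: "(real^3) set set"
    and \<nu> :: "(real^3) set \<Rightarrow> real^3 \<Rightarrow> real^3"
    and u :: "real \<Rightarrow> real^3 \<Rightarrow> real^3"
    and \<gamma> :: "real \<Rightarrow> (real^3) set \<Rightarrow> real^3 \<Rightarrow> real^3"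
  assumes "oriented_triangulation \<T> \<nu>"
    and "\<And>\<epsilon>. \<epsilon> > 0 \<Longrightarrow> displacement \<T> (u \<epsilon>)"
    and "\<And>\<epsilon>. \<epsilon> > 0 \<Longrightarrow> shear \<T> \<nu> (\<gamma> \<epsilon>)"
    and "\<And>T. T \<in> \<T> \<Longrightarrow> order_eps T 1 (\<lambda>\<epsilon>. surf_jac T (\<nu> T) (u \<epsilon>))"
    and "\<And>T. T \<in> \<T> \<Longrightarrow> order_eps T 1 (\<lambda>\<epsilon>. \<gamma> \<epsilon> T)"
    and "\<And>T. T \<in> \<T> \<Longrightarrow> order_eps T 1 (\<lambda>\<epsilon>. surf_jac T (\<nu> T) (\<gamma> \<epsilon> T))"
  shows "\<forall>T\<in>\<T>.
     order_eps T 2 (\<lambda>\<epsilon> x.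
        director T (\<nu> T) (u \<epsilon>) (\<gamma> \<epsilon> T) x
        - (\<nu> T x - transpose (surf_jac T (\<nu> T) (u \<epsilon>) x) *v \<nu> T x + \<gamma> \<epsilon> T x)) \<and>
     order_eps T 2 (\<lambda>\<epsilon> x.
        green_strain T (\<nu> T) (u \<epsilon>) x - sym_part (surf_cov T (\<nu> T) (u \<epsilon>) x)) \<and>
     ((\<forall>i. order_eps T 1 (\<lambda>\<epsilon>. surf_hess T (\<nu> T) (\<lambda>y. u \<epsilon> y $ i))) \<longrightarrow>
      order_eps T 2 (\<lambda>\<epsilon> x.
        - (hess_contr T (\<nu> T) (u \<epsilon>) (director T (\<nu> T) (u \<epsilon>) (\<gamma> \<epsilon> T)) x
           + (1 - director T (\<nu> T) (u \<epsilon>) (\<gamma> \<epsilon> T) x \<bullet> \<nu> T x) *\<^sub>R surf_jac T (\<nu> T) (\<nu> T) x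
           - surf_jac T (\<nu> T) (\<gamma> \<epsilon> T) x)
        - (- (hess_contr T (\<nu> T) (u \<epsilon>) (\<nu> T) x - surf_jac T (\<nu> T) (\<gamma> \<epsilon> T) x))))"
proof
  fix T assume "T \<in> \<T>"
  define n where "n = \<nu> T"
  define J where "J = (\<lambda>\<epsilon>. surf_jac T n (u \<epsilon>))"
  define g where "g = (\<lambda>\<epsilon>. \<gamma> \<epsilon> T)"
  define d where "d = (\<lambda>\<epsilon>. director T n (u \<epsilon>) (g \<epsilon>))"
  define R where "R = (\<lambda>\<epsilon> x. d \<epsilon> x - (n x - transpose (J \<epsilon> x) *v n x + g \<epsilon> x))"
  have T: "curved_element T" "unit_normal T n"
    using assms(1) \<open>T \<in> \<T>\<close> by (auto simp: oriented_triangulation_def n_def)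
  have u: "elem_smooth T (u \<epsilon>)" if "\<epsilon> > 0" for \<epsilon>
    using assms(2)[OF that] \<open>T \<in> \<T>\<close> by (simp add: displacement_def)
  have gn: "g \<epsilon> x \<bullet> n x = 0" if "\<epsilon> > 0" "x \<in> T" for \<epsilon> x
    using assms(3)[OF that(1)] \<open>T \<in> \<T>\<close> that(2) by (simp add: shear_def g_def n_def)
  have n1: "norm (n x) = 1" if "x \<in> T" for x
    using T that by (simp add: unit_normal_def)
  have Jn: "J \<epsilon> x *v n x = 0" if "x \<in> T" for \<epsilon> x
    using surf_jac_normal[OF T(2) that] by (simp add: J_def)
  have J: "order_eps T 1 J" and g: "order_eps T 1 g"
    using assms(4,5) \<open>T \<in> \<T>\<close> by (simp_all add: J_def g_def n_def)
  have JJ: "order_eps T 2 (\<lambda>\<epsilon> x. norm (J \<epsilon> x) * norm (J \<epsilon> x))"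
    and Jg: "order_eps T 2 (\<lambda>\<epsilon> x. norm (J \<epsilon> x) * norm (g \<epsilon> x))"
    using order_eps_mult[OF J J] order_eps_mult[OF J g] by (simp_all add: numeral_2_eq_2)
  have pos: "\<forall>\<^sub>F \<epsilon> in at_right (0::real). \<epsilon> > 0" by (rule eventually_at_right_less)
  have R: "order_eps T 2 R"
  proof -
    obtain \<delta> where \<delta>: "\<delta> > 0" "\<And>A::real^3^3. norm A < \<delta> \<Longrightarrow> det (mat 1 + A) > 0"
      using det_near_identity by blast
    have "\<forall>\<^sub>F \<epsilon> in at_right 0. \<forall>x\<in>T. norm (J \<epsilon> x) < min (1/6) \<delta>"
      using J \<delta> by (intro order_eps_eventually_less) auto
    with pos have "\<forall>\<^sub>F \<epsilon> in at_right 0. \<forall>x\<in>T. norm (R \<epsilon> x) \<le>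
        6 * norm (norm (J \<epsilon> x) * norm (J \<epsilon> x) + norm (J \<epsilon> x) * norm (g \<epsilon> x))"
    proof eventually_elim
      case (elim \<epsilon>)
      show ?case
      proof
        fix x assume x: "x \<in> T"
        then have "norm (J \<epsilon> x) < min (1/6) \<delta>" using elim by blast
        then have "norm (J \<epsilon> x) \<le> 1/6" "det (mat 1 + J \<epsilon> x) > 0" using \<delta> by simp_all
        then have "norm (R \<epsilon> x) \<le> 3 * (norm (J \<epsilon> x))\<^sup>2 + 6 * norm (J \<epsilon> x) * norm (g \<epsilon> x)"
          unfolding R_def d_def J_def
          by (intro director_expansion[where g = "g \<epsilon>", OF T u[OF elim(1)] x gn[OF elim(1) x]])
        \<comment> \<open>The quadratic coefficient 3 is raised to 6 to use one common factor.\<close>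
        also have "\<dots> \<le> 6 * (norm (J \<epsilon> x) * norm (J \<epsilon> x) + norm (J \<epsilon> x) * norm (g \<epsilon> x))"
          by (simp add: power2_eq_square)
        finally show "norm (R \<epsilon> x) \<le>
            6 * norm (norm (J \<epsilon> x) * norm (J \<epsilon> x) + norm (J \<epsilon> x) * norm (g \<epsilon> x))" by simp
      qed
    qed
    then show ?thesis by (rule order_eps_mono[OF order_eps_add[OF JJ Jg], rotated]) simp
  qed
  have E: "order_eps T 2 (\<lambda>\<epsilon> x. green_strain T n (u \<epsilon>) x - sym_part (surf_cov T n (u \<epsilon>) x))"
  proof (rule order_eps_mono[OF JJ])
    show "\<forall>\<^sub>F \<epsilon> in at_right 0. \<forall>x\<in>T. norm (green_strain T n (u \<epsilon>) x - sym_part (surf_cov T n (u \<epsilon>) x))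
        \<le> (1/2) * norm (norm (J \<epsilon> x) * norm (J \<epsilon> x))"
      using pos
    proof eventually_elim
      case (elim \<epsilon>)
      have "norm (transpose (J \<epsilon> x) ** J \<epsilon> x) \<le> norm (J \<epsilon> x) * norm (J \<epsilon> x)" for x
        using norm_matrix_matrix_le[of "transpose (J \<epsilon> x)" "J \<epsilon> x"] by simp
      then show ?case
        using green_strain_expansion[OF T u[OF elim]] by (simp add: J_def)
    qed
  qed simp
  have H: "order_eps T 2 (\<lambda>\<epsilon> x.
        - (hess_contr T n (u \<epsilon>) (d \<epsilon>) x + (1 - d \<epsilon> x \<bullet> n x) *\<^sub>R surf_jac T n n x - surf_jac T n (g \<epsilon>) x)
        - (- (hess_contr T n (u \<epsilon>) n x - surf_jac T n (g \<epsilon>) x)))"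
    if hess: "\<And>i. order_eps T 1 (\<lambda>\<epsilon>. surf_hess T n (\<lambda>y. u \<epsilon> y $ i))"
  proof -
    have "elem_smooth T n" using T by (simp add: unit_normal_def)
    then have "bounded (surf_jac T n n ` T)" by (rule bounded_surf_jac[OF T])
    then obtain b where "\<forall>B \<in> surf_jac T n n ` T. norm B \<le> b" unfolding bounded_iff ..
    then have b: "norm (surf_jac T n n x) \<le> b" if "x \<in> T" for x using that by simp
    have dn: "order_eps T 1 (\<lambda>\<epsilon> x. d \<epsilon> x - n x)"
    proof -
      have "order_eps T 1 R" using R order_eps_SucD[of T 1 R] by (simp add: numeral_2_eq_2)
      moreover have "order_eps T 1 (\<lambda>\<epsilon> x. - (transpose (J \<epsilon> x) *v n x))"
      proof (rule order_eps_mono[OF J, of 1])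
        show "\<forall>\<^sub>F \<epsilon> in at_right 0. \<forall>x\<in>T. norm (- (transpose (J \<epsilon> x) *v n x)) \<le> 1 * norm (J \<epsilon> x)"
        proof (intro always_eventually allI ballI)
          fix \<epsilon> x assume "x \<in> T"
          then show "norm (- (transpose (J \<epsilon> x) *v n x)) \<le> 1 * norm (J \<epsilon> x)"
            using norm_matrix_vector_le[of "transpose (J \<epsilon> x)" "n x"] n1 by simp
        qed
      qed simp
      ultimately have "order_eps T 1 (\<lambda>\<epsilon> x. R \<epsilon> x + - (transpose (J \<epsilon> x) *v n x) + g \<epsilon> x)"
        using g by (intro order_eps_add)
      then show ?thesis by (simp add: R_def)
    qed
    let ?S = "\<lambda>\<epsilon> x. \<Sum>i\<in>UNIV. norm (d \<epsilon> x - n x) * norm (surf_hess T n (\<lambda>y. u \<epsilon> y $ i) x)"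
    have S: "order_eps T 2 ?S"
      using order_eps_mult[OF dn hess] by (intro order_eps_sum) (simp add: numeral_2_eq_2)
    have bR: "order_eps T 2 (\<lambda>\<epsilon> x. \<bar>b\<bar> * norm (R \<epsilon> x))"
      by (rule order_eps_mono[OF R, of "\<bar>b\<bar>"]) (auto simp: abs_mult)
    show ?thesis
    proof (rule order_eps_mono[OF order_eps_add[OF S bR], of 1])
      show "\<forall>\<^sub>F \<epsilon> in at_right 0. \<forall>x\<in>T. norm (
          - (hess_contr T n (u \<epsilon>) (d \<epsilon>) x + (1 - d \<epsilon> x \<bullet> n x) *\<^sub>R surf_jac T n n x - surf_jac T n (g \<epsilon>) x)
          - (- (hess_contr T n (u \<epsilon>) n x - surf_jac T n (g \<epsilon>) x)))
        \<le> 1 * norm (?S \<epsilon> x + \<bar>b\<bar> * norm (R \<epsilon> x))"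
        using pos
      proof eventually_elim
        case (elim \<epsilon>)
        show ?case
        proof
          fix x assume x: "x \<in> T"
          let ?D = "hess_contr T n (u \<epsilon>) (d \<epsilon>) x - hess_contr T n (u \<epsilon>) n x"
          have "(transpose (J \<epsilon> x) *v n x) \<bullet> n x = 0"
            by (simp add: inner_transpose_mult Jn[OF x])
          \<comment> \<open>The first-order part of the director is orthogonal to \<open>n\<close>, so only the remainder contributes.\<close>
          then have "1 - d \<epsilon> x \<bullet> n x = - (R \<epsilon> x \<bullet> n x)"
            using n1[OF x] gn[OF elim x]
            by (simp add: R_def inner_diff_left inner_add_left norm_eq_1)
          then have "\<bar>1 - d \<epsilon> x \<bullet> n x\<bar> \<le> norm (R \<epsilon> x)"
            using Cauchy_Schwarz_ineq2[of "R \<epsilon> x" "n x"] n1[OF x] by simp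
          then have "norm ((1 - d \<epsilon> x \<bullet> n x) *\<^sub>R surf_jac T n n x) \<le> norm (R \<epsilon> x) * \<bar>b\<bar>"
            using b[OF x] by (simp add: mult_mono)
          moreover have "norm ?D \<le> ?S \<epsilon> x" by (rule norm_hess_contr_diff_le)
          ultimately have "norm (?D + (1 - d \<epsilon> x \<bullet> n x) *\<^sub>R surf_jac T n n x)
              \<le> ?S \<epsilon> x + norm (R \<epsilon> x) * \<bar>b\<bar>"
            by (intro norm_triangle_mono)
          also have "\<dots> \<le> 1 * norm (?S \<epsilon> x + \<bar>b\<bar> * norm (R \<epsilon> x))"
            by (simp add: mult.commute)
          finally have "norm (- (?D + (1 - d \<epsilon> x \<bullet> n x) *\<^sub>R surf_jac T n n x))
              \<le> 1 * norm (?S \<epsilon> x + \<bar>b\<bar> * norm (R \<epsilon> x))"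
            by (simp only: norm_minus_cancel)
          then show "norm (
              - (hess_contr T n (u \<epsilon>) (d \<epsilon>) x + (1 - d \<epsilon> x \<bullet> n x) *\<^sub>R surf_jac T n n x
                  - surf_jac T n (g \<epsilon>) x)
              - (- (hess_contr T n (u \<epsilon>) n x - surf_jac T n (g \<epsilon>) x)))
            \<le> 1 * norm (?S \<epsilon> x + \<bar>b\<bar> * norm (R \<epsilon> x))"
            by (simp add: algebra_simps)
        qed
      qed
    qed simp
  qed
  show "order_eps T 2 (\<lambda>\<epsilon> x.
        director T (\<nu> T) (u \<epsilon>) (\<gamma> \<epsilon> T) x
        - (\<nu> T x - transpose (surf_jac T (\<nu> T) (u \<epsilon>) x) *v \<nu> T x + \<gamma> \<epsilon> T x)) \<and>
     order_eps T 2 (\<lambda>\<epsilon> x.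
        green_strain T (\<nu> T) (u \<epsilon>) x - sym_part (surf_cov T (\<nu> T) (u \<epsilon>) x)) \<and>
     ((\<forall>i. order_eps T 1 (\<lambda>\<epsilon>. surf_hess T (\<nu> T) (\<lambda>y. u \<epsilon> y $ i))) \<longrightarrow>
      order_eps T 2 (\<lambda>\<epsilon> x.
        - (hess_contr T (\<nu> T) (u \<epsilon>) (director T (\<nu> T) (u \<epsilon>) (\<gamma> \<epsilon> T)) x
           + (1 - director T (\<nu> T) (u \<epsilon>) (\<gamma> \<epsilon> T) x \<bullet> \<nu> T x) *\<^sub>R surf_jac T (\<nu> T) (\<nu> T) x
           - surf_jac T (\<nu> T) (\<gamma> \<epsilon> T) x)
        - (- (hess_contr T (\<nu> T) (u \<epsilon>) (\<nu> T) x - surf_jac T (\<nu> T) (\<gamma> \<epsilon> T) x))))"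
    using R E H unfolding R_def d_def J_def g_def n_def by (intro conjI impI) simp_all
qed

end
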